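(* Let $k\ge1$ and $n\ge4$ be integers. The rank over $\mathbb{Z}_2$ of any $(n,k)$-matrix is at least $(n-3)^2/2^k$.
   Context: $[n]=\{1,\dots,n\}$. A $k$-octahedron is a tuple $P=P_1*\dots*P_{k+1}$ of 2-element subsets $P_i\subset[n]$, identified with the set of $k$-faces $\{(1,a_1),\dots,(k+1,a_{k+1})\}$, $a_i\in P_i$, of the complex $[n]^{*k+1}$ (vertex set $[k+1]\times[n]$, $k$-faces spanned by one vertex from each $\{i\}\times[n]$). $P,Q$ are vertex-disjoint if $P_i\cap Q_i=\emptyset$ for all $i$; $\oplus$ is symmetric difference of sets of $k$-faces. An $(n,k)$-matrix is a $\mathbb{Z}_2$-matrix $A$ indexed (rows and columns) by all $k$-octahedra such that: $A$ is symmetric; $A_{P,Q}=0$ whenever $P,Q$ are vertex-disjoint; $A_{P,Q}=A_{X,Q}+A_{Y,Q}$ whenever $P=X\oplus Y$ for $k$-octahedra $X,Y$; and $\sum A_{P,Q}=1$, the sum over all unordered pairs $\{P,Q\}$ of $k$-octahedra with $P_i,Q_i\subset[3]$ and $P_i\cap Q_i=\{1\}$ for all $i\in[k+1]$. *)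

theory Defs
  imports Complex_Main "HOL-Library.FuncSet" "HOL-Library.Function_Algebras" "HOL-Library.Z2"
begin

definition fun_scale :: "'b::field \<Rightarrow> ('a \<Rightarrow> 'b) \<Rightarrow> 'a \<Rightarrow> 'b" where
  "fun_scale c f = (\<lambda>x. c * f x)"

global_interpretation fun_vs: vector_space "fun_scale :: 'b::field \<Rightarrow> ('a \<Rightarrow> 'b) \<Rightarrow> 'a \<Rightarrow> 'b"
  by standard (auto simp: fun_scale_def fun_eq_iff algebra_simps)

text \<open>
  A matrix over a field with rows indexed by \<open>I\<close> and columns indexed by \<open>J\<close> is a function of two
  arguments whose values outside \<open>I \<times> J\<close> are irrelevant; columns are therefore cut off to zero
  outside \<open>I\<close> before taking the dimension of the column space.
\<close>

definition mat_column :: "'i set \<Rightarrow> ('i \<Rightarrow> 'j \<Rightarrow> 'b::field) \<Rightarrow> 'j \<Rightarrow> 'i \<Rightarrow> 'b" where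
  "mat_column I A j = (\<lambda>i. if i \<in> I then A i j else 0)"

definition mat_rank :: "'i set \<Rightarrow> 'j set \<Rightarrow> ('i \<Rightarrow> 'j \<Rightarrow> 'b::field) \<Rightarrow> nat" where
  "mat_rank I J A = fun_vs.dim (mat_column I A ` J)"

text \<open>A \<open>k\<close>-octahedron is the tuple of its \<open>k + 1\<close> two-element sets, as an extensional function.\<close>

type_synonym octahedron = "nat \<Rightarrow> nat set"

definition octahedra :: "nat \<Rightarrow> nat \<Rightarrow> octahedron set" where
  "octahedra n k = ({1..k+1} \<rightarrow>\<^sub>E {S. S \<subseteq> {1..n} \<and> card S = 2})"

definition faces :: "nat \<Rightarrow> octahedron \<Rightarrow> (nat \<times> nat) set set" where
  "faces k P = {{(i, a i) | i. i \<in> {1..k+1}} | a. \<forall>i\<in>{1..k+1}. a i \<in> P i}"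

definition vertex_disjoint :: "nat \<Rightarrow> octahedron \<Rightarrow> octahedron \<Rightarrow> bool" where
  "vertex_disjoint k P Q \<longleftrightarrow> (\<forall>i\<in>{1..k+1}. P i \<inter> Q i = {})"

text \<open>
  The entry of a symmetric matrix at an unordered pair of indices; the description is
  well defined exactly because of the symmetry.
\<close>

definition pair_entry :: "('i \<Rightarrow> 'i \<Rightarrow> 'b) \<Rightarrow> 'i set \<Rightarrow> 'b" where
  "pair_entry A e = (THE v. \<exists>P Q. e = {P, Q} \<and> v = A P Q)"

lemma pair_entry_eq: "pair_entry A {P, Q} = A P Q" if "A P Q = A Q P"
  unfolding pair_entry_def using that by (intro the_equality) (auto simp: doubleton_eq_iff)

definition special_pairs :: "nat \<Rightarrow> nat \<Rightarrow> octahedron set set" where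
  "special_pairs n k = {{P, Q} | P Q. P \<in> octahedra n k \<and> Q \<in> octahedra n k \<and>
     (\<forall>i\<in>{1..k+1}. P i \<subseteq> {1..3} \<and> Q i \<subseteq> {1..3} \<and> P i \<inter> Q i = {1})}"

definition nk_matrix :: "nat \<Rightarrow> nat \<Rightarrow> (octahedron \<Rightarrow> octahedron \<Rightarrow> bit) \<Rightarrow> bool" where
  "nk_matrix n k A \<longleftrightarrow>
     (\<forall>P\<in>octahedra n k. \<forall>Q\<in>octahedra n k. A P Q = A Q P) \<and>
     (\<forall>P\<in>octahedra n k. \<forall>Q\<in>octahedra n k. vertex_disjoint k P Q \<longrightarrow> A P Q = 0) \<and>
     (\<forall>P\<in>octahedra n k. \<forall>X\<in>octahedra n k. \<forall>Y\<in>octahedra n k. \<forall>Q\<in>octahedra n k.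
        faces k P = sym_diff (faces k X) (faces k Y) \<longrightarrow> A P Q = A X Q + A Y Q) \<and>
     (\<Sum>e\<in>special_pairs n k. pair_entry A e) = 1"

end

theory Submission
  imports Defs
begin

text \<open>
  Octahedra are pure tensors of edges, and an \<open>(n,k)\<close>-matrix is a symmetric form that is additive
  in each tensor factor. If \<open>P\<close> and \<open>Q\<close> are disjoint outside one coordinate, the entry depends only
  on the vertex shared in that coordinate, and not on the order of the two edges meeting there.
  Therefore summing over the two placements of \<open>{1,2}\<close>, \<open>{1,3}\<close> in the last coordinate turns an
  \<open>(n,k+1)\<close>-matrix into an \<open>(n,k)\<close>-matrix of at most twice the rank, which reduces to \<open>k = 1\<close>.

  For \<open>k = 1\<close> take rows \<open>{2,b} * {1,x}\<close> and columns \<open>{1,c} * {1,y}\<close> with \<open>b, c \<in> {3..n}\<close> and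
  \<open>x, y \<in> {2..n}\<close>, grouped into blocks by \<open>b\<close> and \<open>c\<close>. Diagonal blocks are tournament matrices
  \<open>V\<close>, that is, \<open>V x y + V y x = 1\<close> for \<open>x \<noteq> y\<close>; off-diagonal blocks are constant off their
  diagonals, hence diagonal after a correction of the part above the block diagonal, which has
  rank at most \<open>n - 3\<close>. A tournament matrix of size \<open>s\<close> has rank at least \<open>(s - 1)/2\<close>, and
  elimination shows that diagonal blocks above the block diagonal do not spoil the sum of these
  bounds. So the rank is at least \<open>(n-2)^2/2 - (n-3) > (n-3)^2/2\<close>.
\<close>

declare add_bit_eq_xor [simp del] mult_bit_eq_and [simp del]

section \<open>Rank over a field\<close>

definition col_indep :: "'i set \<Rightarrow> 'j set \<Rightarrow> ('i \<Rightarrow> 'j \<Rightarrow> 'b::field) \<Rightarrow> bool" where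
  "col_indep I Y M \<longleftrightarrow>
     (\<forall>\<alpha>. (\<forall>i\<in>I. (\<Sum>j\<in>Y. \<alpha> j * M i j) = 0) \<longrightarrow> (\<forall>j\<in>Y. \<alpha> j = 0))"

lemma sum_fun_scale_eq_0_iff:
  "(\<Sum>j\<in>Y. fun_scale (\<alpha> j) (mat_column I M j)) = 0 \<longleftrightarrow> (\<forall>i\<in>I. (\<Sum>j\<in>Y. \<alpha> j * M i j) = 0)"
proof -
  have "(\<Sum>j\<in>Y. fun_scale (\<alpha> j) (mat_column I M j)) i = (if i \<in> I then \<Sum>j\<in>Y. \<alpha> j * M i j else 0)"
    for i
    by (induction Y rule: infinite_finite_induct) (auto simp: fun_scale_def mat_column_def)
  then show ?thesis
    by (auto simp: fun_eq_iff)
qed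

lemma col_indep_imp_inj_on:
  assumes "finite Y" "col_indep I Y M"
  shows "inj_on (mat_column I M) Y"
proof (rule inj_onI, rule ccontr)
  fix p q assume pq: "p \<in> Y" "q \<in> Y" "mat_column I M p = mat_column I M q" "p \<noteq> q"
  define \<alpha> where "\<alpha> j = (if j = p then 1 else if j = q then -1 else 0 :: 'c)" for j
  have "(\<Sum>j\<in>Y. \<alpha> j * M i j) = 0" if "i \<in> I" for i
  proof -
    have "(\<Sum>j\<in>Y. \<alpha> j * M i j) = (\<Sum>j\<in>{p, q}. \<alpha> j * M i j)"
      by (rule sum.mono_neutral_right) (use pq assms in \<open>auto simp: \<alpha>_def\<close>)
    also have "\<dots> = M i p - M i q"
      using pq(4) by (simp add: \<alpha>_def)
    also have "\<dots> = 0"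
      using fun_cong[OF pq(3), of i] that by (simp add: mat_column_def)
    finally show ?thesis .
  qed
  then have "\<alpha> p = 0"
    using assms(2) pq(1) by (auto simp: col_indep_def)
  then show False
    by (simp add: \<alpha>_def)
qed

lemma col_indep_iff:
  assumes "finite Y"
  shows "col_indep I Y M \<longleftrightarrow>
    inj_on (mat_column I M) Y \<and> fun_vs.independent (mat_column I M ` Y)"
proof (cases "inj_on (mat_column I M) Y")
  case True
  have eq: "(\<Sum>v\<in>mat_column I M ` Y. fun_scale (u v) v) =
      (\<Sum>j\<in>Y. fun_scale (u (mat_column I M j)) (mat_column I M j))" for u
    by (rule sum.reindex_cong[OF True]) auto
  have "fun_vs.independent (mat_column I M ` Y) \<longleftrightarrow> col_indep I Y M"
  proof
    assume ind: "fun_vs.independent (mat_column I M ` Y)"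
    show "col_indep I Y M"
      unfolding col_indep_def
    proof (intro allI impI)
      fix \<alpha> assume 0: "\<forall>i\<in>I. (\<Sum>j\<in>Y. \<alpha> j * M i j) = 0"
      define u where "u v = \<alpha> (the_inv_into Y (mat_column I M) v)" for v
      have u: "u (mat_column I M j) = \<alpha> j" if "j \<in> Y" for j
        using the_inv_into_f_f[OF True that] by (simp add: u_def)
      have "(\<Sum>v\<in>mat_column I M ` Y. fun_scale (u v) v) = 0"
        using 0 by (simp add: eq u sum_fun_scale_eq_0_iff cong: sum.cong)
      then have "\<forall>v\<in>mat_column I M ` Y. u v = 0"
        using ind assms fun_vs.dependent_finite by blast
      then show "\<forall>j\<in>Y. \<alpha> j = 0"
        using u by auto
    qed
  next
    assume "col_indep I Y M"
    then show "fun_vs.independent (mat_column I M ` Y)"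
      using assms by (auto simp: fun_vs.dependent_finite eq sum_fun_scale_eq_0_iff col_indep_def)
  qed
  then show ?thesis
    using True by simp
next
  case False
  then show ?thesis
    using col_indep_imp_inj_on[OF assms] by blast
qed

lemma mat_rank_ge:
  assumes "finite J" "Y \<subseteq> J" "col_indep I Y M"
  shows "card Y \<le> mat_rank I J M"
proof -
  have fin: "finite Y"
    using assms finite_subset by blast
  obtain B where B: "B \<subseteq> mat_column I M ` J" "mat_column I M ` J \<subseteq> fun_vs.span B"
      "card B = mat_rank I J M"
    using fun_vs.basis_exists[of "mat_column I M ` J"] unfolding mat_rank_def by metis
  have "finite B"
    using B(1) assms(1) finite_subset by blast
  moreover have "mat_column I M ` Y \<subseteq> fun_vs.span B"
    using B(2) assms(2) by blast
  moreover have "fun_vs.independent (mat_column I M ` Y)" "inj_on (mat_column I M) Y"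
    using assms(3) col_indep_iff[OF fin] by blast+
  ultimately show ?thesis
    using fun_vs.independent_span_bound B(3) by (metis card_image)
qed

lemma mat_rank_basis:
  assumes "finite J"
  obtains Y where "Y \<subseteq> J" "finite Y" "card Y = mat_rank I J M" "col_indep I Y M"
proof -
  obtain B where B: "B \<subseteq> mat_column I M ` J" "fun_vs.independent B" "card B = mat_rank I J M"
    using fun_vs.basis_exists[of "mat_column I M ` J"] unfolding mat_rank_def by metis
  obtain Y where Y: "Y \<subseteq> J" "inj_on (mat_column I M) Y" "B = mat_column I M ` Y"
    using B(1) subset_image_inj by metis
  have "finite Y"
    using Y(1) assms finite_subset by blast
  with Y B that show ?thesis
    by (metis card_image col_indep_iff)
qed

lemma mat_rank_le:
  assumes "finite L" "\<And>i j. i \<in> I \<Longrightarrow> j \<in> J \<Longrightarrow> M i j = (\<Sum>l\<in>L. u l i * v l j)"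
  shows "mat_rank I J M \<le> card L"
proof -
  let ?U = "\<lambda>l i. if i \<in> I then u l i else 0"
  have "mat_column I M j \<in> fun_vs.span (?U ` L)" if "j \<in> J" for j
  proof -
    have "mat_column I M j i = (\<Sum>l\<in>L. fun_scale (v l j) (?U l)) i" for i
    proof -
      have "(\<Sum>l\<in>L. fun_scale (v l j) (?U l)) i = (if i \<in> I then \<Sum>l\<in>L. u l i * v l j else 0)"
        by (induction L rule: infinite_finite_induct) (auto simp: fun_scale_def mult.commute)
      with assms(2) that show ?thesis
        by (simp add: mat_column_def)
    qed
    then have "mat_column I M j = (\<Sum>l\<in>L. fun_scale (v l j) (?U l))"
      by blast
    also have "\<dots> \<in> fun_vs.span (?U ` L)"
      by (rule fun_vs.span_sum, rule fun_vs.span_scale, rule fun_vs.span_base) simp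
    finally show ?thesis .
  qed
  then have "mat_rank I J M \<le> card (?U ` L)"
    unfolding mat_rank_def by (intro fun_vs.dim_le_card) (use assms(1) in auto)
  also have "\<dots> \<le> card L"
    using assms(1) by (rule card_image_le)
  finally show ?thesis .
qed

lemma mat_rank_factorization:
  assumes "finite J"
  obtains u v where "\<And>i j. i \<in> I \<Longrightarrow> j \<in> J \<Longrightarrow> M i j = (\<Sum>l<mat_rank I J M. u l i * v l j)"
proof -
  obtain B where B: "B \<subseteq> mat_column I M ` J" "fun_vs.independent B"
      "mat_column I M ` J \<subseteq> fun_vs.span B" "card B = mat_rank I J M"
    using fun_vs.basis_exists[of "mat_column I M ` J"] unfolding mat_rank_def by metis
  have fin: "finite B"
    using B(1) assms finite_subset by blast
  then obtain h where h: "bij_betw h {..<mat_rank I J M} B"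
    using B(4) ex_bij_betw_nat_finite[OF fin] by (metis atLeast0LessThan)
  define r where "r j b = fun_vs.representation B (mat_column I M j) b" for j b
  have "M i j = (\<Sum>l<mat_rank I J M. h l i * r j (h l))" if "i \<in> I" "j \<in> J" for i j
  proof -
    have "mat_column I M j = (\<Sum>b\<in>B. fun_scale (r j b) b)"
      unfolding r_def using fun_vs.sum_representation_eq[OF B(2) _ fin order.refl] B(3) that(2) by auto
    moreover have "(\<Sum>b\<in>B. fun_scale (r j b) b) i = (\<Sum>b\<in>B. b i * r j b)"
      by (induction B rule: infinite_finite_induct) (auto simp: fun_scale_def)
    ultimately have "M i j = (\<Sum>b\<in>B. b i * r j b)"
      using that(1) by (metis mat_column_def)
    also have "\<dots> = (\<Sum>l<mat_rank I J M. h l i * r j (h l))"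
      by (rule sum.reindex_bij_betw[OF h, symmetric])
    finally show ?thesis .
  qed
  then show ?thesis
    by (rule that)
qed

lemma mat_rank_reindex_le:
  assumes "finite J" "f ` I' \<subseteq> I" "g ` J' \<subseteq> J" "\<And>i j. i \<in> I' \<Longrightarrow> j \<in> J' \<Longrightarrow> M' i j = M (f i) (g j)"
  shows "mat_rank I' J' M' \<le> mat_rank I J M"
proof -
  obtain u v where "\<And>i j. i \<in> I \<Longrightarrow> j \<in> J \<Longrightarrow> M i j = (\<Sum>l<mat_rank I J M. u l i * v l j)"
    using mat_rank_factorization[OF assms(1)] by blast
  then have "mat_rank I' J' M' \<le> card {..<mat_rank I J M}"
    by (intro mat_rank_le[where u = "\<lambda>l i. u l (f i)" and v = "\<lambda>l j. v l (g j)"])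
      (use assms in \<open>auto simp: image_subset_iff\<close>)
  then show ?thesis
    by simp
qed

lemma mat_rank_mono:
  assumes "finite J" "I' \<subseteq> I" "J' \<subseteq> J"
  shows "mat_rank I' J' M \<le> mat_rank I J M"
  using assms by (intro mat_rank_reindex_le[where f = id and g = id]) auto

lemma mat_rank_add_le:
  assumes "finite J" "\<And>i j. i \<in> I \<Longrightarrow> j \<in> J \<Longrightarrow> M i j = M1 i j + M2 i j"
  shows "mat_rank I J M \<le> mat_rank I J M1 + mat_rank I J M2"
proof -
  let ?r = "mat_rank I J M1" and ?s = "mat_rank I J M2"
  obtain u1 v1 where 1: "\<And>i j. i \<in> I \<Longrightarrow> j \<in> J \<Longrightarrow> M1 i j = (\<Sum>l<?r. u1 l i * v1 l j)"
    using mat_rank_factorization[OF assms(1)] by blast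
  obtain u2 v2 where 2: "\<And>i j. i \<in> I \<Longrightarrow> j \<in> J \<Longrightarrow> M2 i j = (\<Sum>l<?s. u2 l i * v2 l j)"
    using mat_rank_factorization[OF assms(1)] by blast
  have "mat_rank I J M \<le> card ({..<?r} <+> {..<?s})"
    by (rule mat_rank_le[where u = "case_sum u1 u2" and v = "case_sum v1 v2"])
      (simp_all add: assms(2) 1 2 sum.Plus)
  then show ?thesis
    by (simp add: card_Plus)
qed

lemma mat_rank_transpose_le:
  assumes "finite I" "finite J"
  shows "mat_rank J I (\<lambda>j i. M i j) \<le> mat_rank I J M"
proof -
  obtain u v where "\<And>i j. i \<in> I \<Longrightarrow> j \<in> J \<Longrightarrow> M i j = (\<Sum>l<mat_rank I J M. u l i * v l j)"
    using mat_rank_factorization[OF assms(2)] by blast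
  then have "mat_rank J I (\<lambda>j i. M i j) \<le> card {..<mat_rank I J M}"
    by (intro mat_rank_le[where u = v and v = u]) (auto simp: mult.commute)
  then show ?thesis
    by simp
qed

lemma mat_rank_identity_ge:
  assumes "finite X"
  shows "card X \<le> mat_rank X X (\<lambda>x y. of_bool (x = y) :: 'b::field)"
proof -
  have "(\<Sum>j\<in>X. \<alpha> j * of_bool (i = j)) = \<alpha> i" if "i \<in> X" for \<alpha> :: "_ \<Rightarrow> 'b" and i
    using that assms by (simp add: of_bool_def if_distrib sum.delta cong: if_cong)
  then have "col_indep X X (\<lambda>x y. of_bool (x = y) :: 'b)"
    by (simp add: col_indep_def)
  then show ?thesis
    using assms by (intro mat_rank_ge) auto
qed

lemma mat_rank_schur:
  assumes "finite J" "p \<in> I" "q \<in> J" "M p q = 1"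
  shows "mat_rank (I - {p}) (J - {q}) (\<lambda>i j. M i j - M i q * M p j) + 1 \<le> mat_rank I J M"
proof -
  obtain Y where Y: "Y \<subseteq> J - {q}" "finite Y"
      "card Y = mat_rank (I - {p}) (J - {q}) (\<lambda>i j. M i j - M i q * M p j)"
      "col_indep (I - {p}) Y (\<lambda>i j. M i j - M i q * M p j)"
    using mat_rank_basis[OF finite_Diff[OF assms(1)]] by blast
  have q: "q \<notin> Y"
    using Y(1) by blast
  have "col_indep I (insert q Y) M"
    unfolding col_indep_def
  proof (intro allI impI)
    fix \<alpha> assume "\<forall>i\<in>I. (\<Sum>j\<in>insert q Y. \<alpha> j * M i j) = 0"
    then have 0: "\<alpha> q * M i q + (\<Sum>j\<in>Y. \<alpha> j * M i j) = 0" if "i \<in> I" for i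
      using that q Y(2) by simp
    have \<alpha>q: "\<alpha> q = - (\<Sum>j\<in>Y. \<alpha> j * M p j)"
      using 0[OF assms(2)] assms(4) by (simp add: eq_neg_iff_add_eq_0)
    have "(\<Sum>j\<in>Y. \<alpha> j * (M i j - M i q * M p j)) = 0" if "i \<in> I" for i
    proof -
      have "(\<Sum>j\<in>Y. \<alpha> j * (M i j - M i q * M p j)) =
          (\<Sum>j\<in>Y. \<alpha> j * M i j) - (\<Sum>j\<in>Y. \<alpha> j * M p j) * M i q"
        by (simp add: algebra_simps sum_subtractf sum_distrib_left)
      also have "\<dots> = 0"
        using 0[OF that] by (simp add: \<alpha>q algebra_simps)
      finally show ?thesis .
    qed
    then have "\<forall>j\<in>Y. \<alpha> j = 0"
      using Y(4) by (simp add: col_indep_def)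
    then show "\<forall>j\<in>insert q Y. \<alpha> j = 0"
      by (simp add: \<alpha>q)
  qed
  then have "card (insert q Y) \<le> mat_rank I J M"
    using Y(1) assms by (intro mat_rank_ge) auto
  then show ?thesis
    using Y q by simp
qed

lemma mat_rank_block_triangular:
  assumes "finite J1" "finite J2" "J1 \<inter> J2 = {}"
    and zero: "\<And>i j. i \<in> I1 \<Longrightarrow> j \<in> J2 \<Longrightarrow> M i j = 0"
  shows "mat_rank I1 J1 M + mat_rank I2 J2 M \<le> mat_rank (I1 \<union> I2) (J1 \<union> J2) M"
proof -
  obtain Y1 where Y1: "Y1 \<subseteq> J1" "finite Y1" "card Y1 = mat_rank I1 J1 M" "col_indep I1 Y1 M"
    using mat_rank_basis[OF assms(1)] by metis
  obtain Y2 where Y2: "Y2 \<subseteq> J2" "finite Y2" "card Y2 = mat_rank I2 J2 M" "col_indep I2 Y2 M"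
    using mat_rank_basis[OF assms(2)] by metis
  have disj: "Y1 \<inter> Y2 = {}"
    using Y1 Y2 assms(3) by blast
  have "col_indep (I1 \<union> I2) (Y1 \<union> Y2) M"
    unfolding col_indep_def
  proof (intro allI impI)
    fix \<alpha> assume "\<forall>i\<in>I1 \<union> I2. (\<Sum>j\<in>Y1 \<union> Y2. \<alpha> j * M i j) = 0"
    then have 0: "(\<Sum>j\<in>Y1. \<alpha> j * M i j) + (\<Sum>j\<in>Y2. \<alpha> j * M i j) = 0" if "i \<in> I1 \<union> I2" for i
      using that Y1(2) Y2(2) disj by (simp add: sum.union_disjoint)
    have "(\<Sum>j\<in>Y2. \<alpha> j * M i j) = 0" if "i \<in> I1" for i
      using zero[OF that] Y2(1) by (intro sum.neutral) auto
    then have "\<forall>i\<in>I1. (\<Sum>j\<in>Y1. \<alpha> j * M i j) = 0"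
      using 0 by fastforce
    then have "\<forall>j\<in>Y1. \<alpha> j = 0"
      using Y1(4) by (simp add: col_indep_def)
    moreover from this have "\<forall>j\<in>Y2. \<alpha> j = 0"
      using 0 Y2(4) by (simp add: col_indep_def)
    ultimately show "\<forall>j\<in>Y1 \<union> Y2. \<alpha> j = 0"
      by blast
  qed
  then have "card (Y1 \<union> Y2) \<le> mat_rank (I1 \<union> I2) (J1 \<union> J2) M"
    using assms Y1(1) Y2(1) by (intro mat_rank_ge) auto
  then show ?thesis
    using Y1 Y2 disj by (simp add: card_Un_disjoint)
qed

section \<open>Tournament matrices and block matrices\<close>

lemma bit_add_self [simp]: "a + a = 0" for a :: bit
  by (cases a) auto

lemma tournament_rank:
  fixes V :: "'a \<Rightarrow> 'a \<Rightarrow> bit"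
  assumes "finite X" "\<And>x y. x \<in> X \<Longrightarrow> y \<in> X \<Longrightarrow> x \<noteq> y \<Longrightarrow> V x y + V y x = 1"
  shows "card X \<le> 2 * mat_rank X X V + 1"
proof -
  have "card X \<le> mat_rank X X (\<lambda>x y. of_bool (x = y) :: bit)"
    using assms(1) by (rule mat_rank_identity_ge)
  also have "\<dots> \<le> mat_rank X X (\<lambda>x y. V x y + V y x) + mat_rank X X (\<lambda>_ _. 1 :: bit)"
    using assms by (intro mat_rank_add_le) (auto simp: of_bool_def)
  also have "mat_rank X X (\<lambda>x y. V x y + V y x) \<le> mat_rank X X V + mat_rank X X (\<lambda>x y. V y x)"
    using assms(1) by (rule mat_rank_add_le) simp
  also have "mat_rank X X (\<lambda>x y. V y x) \<le> mat_rank X X V"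
    using assms(1) assms(1) by (rule mat_rank_transpose_le)
  also have "mat_rank X X (\<lambda>_ _. 1 :: bit) \<le> card {()}"
    by (rule mat_rank_le[where u = "\<lambda>_ _. 1" and v = "\<lambda>_ _. 1"]) auto
  finally show ?thesis
    by simp
qed

text \<open>
  Nonzero entries of the last block column above its diagonal block are used as pivots, each in the
  topmost block row that meets its column: then clearing the column disturbs only blocks below the
  diagonal, where nothing is assumed. Each pivot gains \<open>1\<close> in the rank and costs at most two of
  the indices \<open>x \<in> R b\<close>.
\<close>

lemma block_tournament_rank:
  fixes N :: "nat \<times> 'a \<Rightarrow> nat \<times> 'a \<Rightarrow> bit"
  assumes "\<And>b. b < m \<Longrightarrow> finite (C b)" "\<And>b. b < m \<Longrightarrow> R b \<subseteq> C b"
    and "\<And>b c x y. b < c \<Longrightarrow> c < m \<Longrightarrow> x \<in> R b \<Longrightarrow> y \<in> C c \<Longrightarrow> x \<noteq> y \<Longrightarrow> N (b, x) (c, y) = 0"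
    and "\<And>b x y. b < m \<Longrightarrow> x \<in> R b \<Longrightarrow> y \<in> R b \<Longrightarrow> x \<noteq> y \<Longrightarrow> N (b, x) (b, y) + N (b, y) (b, x) = 1"
  shows "(\<Sum>b<m. card (R b)) \<le> 2 * mat_rank (Sigma {..<m} R) (Sigma {..<m} C) N + m"
  using assms
proof (induction m arbitrary: R C N)
  case 0
  then show ?case by simp
next
  case (Suc m)
  note outer = Suc.IH
  from Suc.prems show ?case
  proof (induction "card (C m)" arbitrary: R C N rule: less_induct)
    case less
    note fin = less.prems(1) and sub = less.prems(2)
      and upper = less.prems(3) and diag = less.prems(4)
    have finR: "finite (R b)" if "b < Suc m" for b
      using fin sub that finite_subset by blast
    have finC: "finite (Sigma {..<Suc m} C)"
      using fin by auto
    show ?case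
    proof (cases "\<exists>b x. b < m \<and> x \<in> R b \<and> x \<in> C m \<and> N (b, x) (m, x) \<noteq> 0")
      case False
      have "mat_rank (Sigma {..<m} R) (Sigma {..<m} C) N
          + mat_rank ({m} \<times> R m) ({m} \<times> C m) N
          \<le> mat_rank (Sigma {..<m} R \<union> {m} \<times> R m) (Sigma {..<m} C \<union> {m} \<times> C m) N"
      proof (rule mat_rank_block_triangular)
        fix i j assume "i \<in> Sigma {..<m} R" "j \<in> {m} \<times> C m"
        then show "N i j = 0"
          using False upper[of _ m] by (cases "snd i = snd j") auto
      qed (use fin in auto)
      also have "Sigma {..<m} R \<union> {m} \<times> R m = Sigma {..<Suc m} R"
        by (auto simp: less_Suc_eq)
      also have "Sigma {..<m} C \<union> {m} \<times> C m = Sigma {..<Suc m} C"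
        by (auto simp: less_Suc_eq)
      finally have 1: "mat_rank (Sigma {..<m} R) (Sigma {..<m} C) N
          + mat_rank ({m} \<times> R m) ({m} \<times> C m) N \<le> mat_rank (Sigma {..<Suc m} R) (Sigma {..<Suc m} C) N" .
      have 2: "(\<Sum>b<m. card (R b)) \<le> 2 * mat_rank (Sigma {..<m} R) (Sigma {..<m} C) N + m"
        by (rule outer) (use fin sub upper diag in auto)
      have "card (R m) \<le> 2 * mat_rank (R m) (R m) (\<lambda>x y. N (m, x) (m, y)) + 1"
        by (rule tournament_rank) (use finR diag in auto)
      also have "mat_rank (R m) (R m) (\<lambda>x y. N (m, x) (m, y)) \<le> mat_rank ({m} \<times> R m) ({m} \<times> C m) N"
        by (rule mat_rank_reindex_le[where f = "Pair m" and g = "Pair m"]) (use fin sub in auto)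
      finally show ?thesis
        using 1 2 by simp
    next
      case True
      then obtain x where ex: "\<exists>b. b < m \<and> x \<in> R b \<and> x \<in> C m \<and> N (b, x) (m, x) \<noteq> 0"
        by blast
      define b where "b = (LEAST b. b < m \<and> x \<in> R b \<and> x \<in> C m \<and> N (b, x) (m, x) \<noteq> 0)"
      have b: "b < m" "x \<in> R b" "x \<in> C m" "N (b, x) (m, x) = 1"
        using LeastI_ex[OF ex] by (auto simp: b_def)
      have least: "b \<le> c" if "c < m" "x \<in> R c" "N (c, x) (m, x) \<noteq> 0" for c
        unfolding b_def using that b(3) by (intro Least_le) auto
      define R' where "R' = R(b := R b - {x}, m := R m - {x})"
      define C' where "C' = C(m := C m - {x})"
      define N' where "N' i j = N i j - N i (m, x) * N (b, x) j" for i j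
      have N'_eq: "N' (c, y) (d, z) = N (c, y) (d, z)"
        if "c \<le> d" "d \<le> m" "y \<in> R' c" "z \<in> C' d" "y \<noteq> z" for c d y z
      proof -
        have "N (c, y) (m, x) * N (b, x) (d, z) = 0"
        proof (cases "d = m")
          case True
          then have "N (b, x) (d, z) = 0"
            using that b upper[of b m x z] by (auto simp: C'_def)
          then show ?thesis by simp
        next
          case False
          with that have cm: "c < m" "d < m"
            by auto
          have yR: "y \<in> R c" "c = b \<Longrightarrow> y \<noteq> x"
            using that(3) cm by (auto simp: R'_def split: if_splits)
          show ?thesis
          proof (cases "y = x \<and> N (c, x) (m, x) \<noteq> 0")
            case True
            then have "b < d"
              using least[of c] yR cm that(1) by force
            then have "N (b, x) (d, z) = 0"
              using upper[of b d x z] that(4,5) True b cm by (auto simp: C'_def)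
            then show ?thesis by simp
          next
            case False
            then show ?thesis
              using upper[of c m y x] yR b cm by auto
          qed
        qed
        then show ?thesis
          by (simp add: N'_def)
      qed
      have IH: "(\<Sum>b<Suc m. card (R' b)) \<le> 2 * mat_rank (Sigma {..<Suc m} R') (Sigma {..<Suc m} C') N' + Suc m"
      proof (rule less.hyps)
        show "card (C' m) < card (C m)"
          using b fin by (simp add: C'_def card_Diff1_less del: card_Diff_insert)
        show "finite (C' c)" "R' c \<subseteq> C' c" if "c < Suc m" for c
          using that fin sub by (auto simp: C'_def R'_def)
        show "N' (c, y) (d, z) = 0" if "c < d" "d < Suc m" "y \<in> R' c" "z \<in> C' d" "y \<noteq> z" for c d y z
          using N'_eq[of c d y z] upper[of c d y z] that
          by (auto simp: C'_def R'_def split: if_splits)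
        show "N' (c, y) (c, z) + N' (c, z) (c, y) = 1"
          if "c < Suc m" "y \<in> R' c" "z \<in> R' c" "y \<noteq> z" for c y z
        proof -
          have "y \<in> C' c" "z \<in> C' c" "y \<in> R c" "z \<in> R c"
            using that sub by (auto simp: C'_def R'_def split: if_splits)
          then show ?thesis
            using N'_eq[of c c y z] N'_eq[of c c z y] diag[of c y z] that by auto
        qed
      qed
      have "mat_rank (Sigma {..<Suc m} R') (Sigma {..<Suc m} C') N'
          \<le> mat_rank (Sigma {..<Suc m} R - {(b, x)}) (Sigma {..<Suc m} C - {(m, x)}) N'"
        by (rule mat_rank_mono)
          (use finC b in \<open>auto simp: C'_def R'_def split: if_splits\<close>)
      moreover have "mat_rank (Sigma {..<Suc m} R - {(b, x)}) (Sigma {..<Suc m} C - {(m, x)}) N' + 1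
          \<le> mat_rank (Sigma {..<Suc m} R) (Sigma {..<Suc m} C) N"
        unfolding N'_def by (rule mat_rank_schur) (use finC b in auto)
      moreover have "(\<Sum>c<Suc m. card (R c)) \<le> (\<Sum>c<Suc m. card (R' c)) + 2"
      proof -
        have "(\<Sum>c<Suc m. card (R c)) \<le> (\<Sum>c<Suc m. card (R' c) + (of_bool (c = b) + of_bool (c = m)))"
        proof (rule sum_mono)
          fix c assume "c \<in> {..<Suc m}"
          then show "card (R c) \<le> card (R' c) + (of_bool (c = b) + of_bool (c = m))"
            using b(1) card_Diff_singleton[of x "R b"] card_Diff_singleton_if[of "R m" x] b(2)
            by (auto simp: R'_def)
        qed
        also have "\<dots> = (\<Sum>c<Suc m. card (R' c)) + 2"
          using b(1) by (simp add: sum.distrib of_bool_def)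
        finally show ?thesis .
      qed
      ultimately show ?thesis
        using IH by linarith
    qed
  qed
qed

section \<open>Forms on edges\<close>

definition edges :: "nat \<Rightarrow> nat set set" where
  "edges n = {S. S \<subseteq> {1..n} \<and> card S = 2}"

lemma doubleton_in_edges_iff [simp]:
  "{a, b} \<in> edges n \<longleftrightarrow> a \<noteq> b \<and> a \<in> {1..n} \<and> b \<in> {1..n}"
  by (auto simp: edges_def card_insert_if)

definition edge_form :: "nat \<Rightarrow> (nat set \<Rightarrow> nat set \<Rightarrow> bit) \<Rightarrow> bool" where
  "edge_form n \<phi> \<longleftrightarrow>
     (\<forall>T\<in>edges n. \<forall>a\<in>{1..n}. \<forall>b\<in>{1..n}. \<forall>c\<in>{1..n}. distinct [a, b, c] \<longrightarrow>
        \<phi> {a, b} T = \<phi> {c, a} T + \<phi> {c, b} T \<and> \<phi> T {a, b} = \<phi> T {c, a} + \<phi> T {c, b}) \<and>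
     (\<forall>S\<in>edges n. \<forall>T\<in>edges n. S \<inter> T = {} \<longrightarrow> \<phi> S T = 0)"

lemma bit_add_eq_0_iff: "a + b = 0 \<longleftrightarrow> a = b" for a b :: bit
  by (cases a; cases b) auto

lemma edge_form_add:
  assumes "edge_form n \<phi>" "T \<in> edges n" "a \<in> {1..n}" "b \<in> {1..n}" "c \<in> {1..n}" "distinct [a, b, c]"
  shows "\<phi> {a, b} T = \<phi> {c, a} T + \<phi> {c, b} T" "\<phi> T {a, b} = \<phi> T {c, a} + \<phi> T {c, b}"
  using assms unfolding edge_form_def by blast+

lemma edge_form_disjoint:
  "edge_form n \<phi> \<Longrightarrow> S \<in> edges n \<Longrightarrow> T \<in> edges n \<Longrightarrow> S \<inter> T = {} \<Longrightarrow> \<phi> S T = 0"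
  unfolding edge_form_def by blast

lemma edge_form_move:
  assumes \<phi>: "edge_form n \<phi>" and mem: "a \<in> {1..n}" "b \<in> {1..n}" "c \<in> {1..n}" "d \<in> {1..n}"
    and ne: "a \<noteq> b" "a \<noteq> c" "a \<noteq> d" "b \<noteq> c" "b \<noteq> d"
  shows "\<phi> {a, b} {a, c} = \<phi> {a, b} {a, d}" "\<phi> {a, c} {a, b} = \<phi> {a, d} {a, b}"
proof -
  have ab: "{a, b} \<in> edges n"
    using mem ne by simp
  have "\<phi> {a, b} {a, c} = \<phi> {a, b} {a, d} \<and> \<phi> {a, c} {a, b} = \<phi> {a, d} {a, b}" if "c \<noteq> d"
  proof -
    have cd: "{c, d} \<in> edges n" "distinct [c, d, a]"
      using mem ne that by simp_all
    have "{a, b} \<inter> {c, d} = {}" "{c, d} \<inter> {a, b} = {}"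
      using ne by blast+
    then have "\<phi> {a, b} {c, d} = 0" "\<phi> {c, d} {a, b} = 0"
      using edge_form_disjoint[OF \<phi>] ab cd(1) by blast+
    then show ?thesis
      using edge_form_add[OF \<phi> ab mem(3,4,1) cd(2)] by (metis bit_add_eq_0_iff)
  qed
  then show "\<phi> {a, b} {a, c} = \<phi> {a, b} {a, d}" "\<phi> {a, c} {a, b} = \<phi> {a, d} {a, b}"
    by blast+
qed

lemma edge_form_const:
  assumes \<phi>: "edge_form n \<phi>" and "n \<ge> 4"
    and mem: "a \<in> {1..n}" "b \<in> {1..n}" "c \<in> {1..n}" "b' \<in> {1..n}" "c' \<in> {1..n}"
    and ne: "b \<noteq> a" "c \<noteq> a" "b' \<noteq> a" "c' \<noteq> a" "b \<noteq> c" "b' \<noteq> c'"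
  shows "\<phi> {a, b} {a, c} = \<phi> {a, b'} {a, c'}"
proof -
  have "\<not> {1..n} \<subseteq> {a, b, c}"
  proof
    assume "{1..n} \<subseteq> {a, b, c}"
    then have "card {1..n} \<le> card {a, b, c}"
      by (rule card_mono[rotated]) simp
    also have "\<dots> \<le> 3"
      by (simp add: card_insert_if)
    finally show False
      using \<open>n \<ge> 4\<close> by simp
  qed
  then obtain d where d: "d \<in> {1..n}" "d \<noteq> a" "d \<noteq> b" "d \<noteq> c"
    by blast
  have L: "\<phi> {a, x} {a, z} = \<phi> {a, y} {a, z}" if "x \<in> {1..n} - {a, z}" "y \<in> {1..n} - {a, z}" "z \<in> {1..n} - {a}"
    for x y z
    using that edge_form_move(2)[OF \<phi>, of a z x y] mem(1) by blast
  have R: "\<phi> {a, z} {a, x} = \<phi> {a, z} {a, y}" if "x \<in> {1..n} - {a, z}" "y \<in> {1..n} - {a, z}" "z \<in> {1..n} - {a}"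
    for x y z
    using that edge_form_move(1)[OF \<phi>, of a z x y] mem(1) by blast
  show ?thesis
  proof (cases "b' = c")
    case False
    then have "\<phi> {a, b} {a, c} = \<phi> {a, b'} {a, c}"
      using mem ne by (intro L) blast+
    also have "\<dots> = \<phi> {a, b'} {a, c'}"
      using mem ne False by (intro R) blast+
    finally show ?thesis .
  next
    case True
    have "\<phi> {a, b} {a, c} = \<phi> {a, b} {a, d}"
      using mem ne d by (intro R) blast+
    also have "\<dots> = \<phi> {a, c} {a, d}"
      using mem ne d by (intro L) blast+
    also have "\<dots> = \<phi> {a, b'} {a, c'}"
      using mem ne d unfolding True by (intro R) blast+
    finally show ?thesis .
  qed
qed

section \<open>Forms on octahedra\<close>

lemma octahedra_altdef: "octahedra n k = {1..k+1} \<rightarrow>\<^sub>E edges n"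
  by (simp add: octahedra_def edges_def)

lemma finite_octahedra [simp]: "finite (octahedra n k)"
proof -
  have "finite (edges n)"
    by (rule finite_subset[of _ "Pow {1..n}"]) (auto simp: edges_def)
  then show ?thesis
    unfolding octahedra_altdef by (intro finite_PiE) auto
qed

lemma octahedra_upd:
  assumes "P \<in> octahedra n k" "i \<in> {1..k+1}" "S \<in> edges n"
  shows "P(i := S) \<in> octahedra n k"
  using PiE_fun_upd[of S "\<lambda>_. edges n" i P "{1..k+1}"] assms by (simp add: octahedra_altdef insert_absorb)

lemma octahedra_extend:
  assumes "P \<in> octahedra n k" "S \<in> edges n"
  shows "P(k+2 := S) \<in> octahedra n (k+1)"
proof -
  have "{1..k+1+1} = insert (k+2) {1..k+1}"
    by auto
  then show ?thesis
    using PiE_fun_upd[of S "\<lambda>_. edges n" "k+2" P "{1..k+1}"] assms by (simp add: octahedra_altdef)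
qed

definition octa_form :: "nat \<Rightarrow> nat \<Rightarrow> (octahedron \<Rightarrow> octahedron \<Rightarrow> bit) \<Rightarrow> bool" where
  "octa_form n k A \<longleftrightarrow>
     (\<forall>P\<in>octahedra n k. \<forall>Q\<in>octahedra n k. A P Q = A Q P) \<and>
     (\<forall>P\<in>octahedra n k. \<forall>Q\<in>octahedra n k. vertex_disjoint k P Q \<longrightarrow> A P Q = 0) \<and>
     (\<forall>P\<in>octahedra n k. \<forall>Q\<in>octahedra n k. \<forall>i\<in>{1..k+1}.
        \<forall>a\<in>{1..n}. \<forall>b\<in>{1..n}. \<forall>c\<in>{1..n}. distinct [a, b, c] \<longrightarrow>
          A (P(i := {a, b})) Q = A (P(i := {c, a})) Q + A (P(i := {c, b})) Q)"

lemma octa_form_sym: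
  "octa_form n k A \<Longrightarrow> P \<in> octahedra n k \<Longrightarrow> Q \<in> octahedra n k \<Longrightarrow> A P Q = A Q P"
  by (simp add: octa_form_def)

lemma octa_form_disjoint:
  "octa_form n k A \<Longrightarrow> P \<in> octahedra n k \<Longrightarrow> Q \<in> octahedra n k \<Longrightarrow> vertex_disjoint k P Q \<Longrightarrow> A P Q = 0"
  by (simp add: octa_form_def)

lemma octa_form_add_left:
  assumes "octa_form n k A" "P \<in> octahedra n k" "Q \<in> octahedra n k" "i \<in> {1..k+1}"
    and "a \<in> {1..n}" "b \<in> {1..n}" "c \<in> {1..n}" "distinct [a, b, c]"
  shows "A (P(i := {a, b})) Q = A (P(i := {c, a})) Q + A (P(i := {c, b})) Q"
  using assms unfolding octa_form_def by blast

lemma octa_form_add_right: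
  assumes "octa_form n k A" "P \<in> octahedra n k" "Q \<in> octahedra n k" "i \<in> {1..k+1}"
    and "a \<in> {1..n}" "b \<in> {1..n}" "c \<in> {1..n}" "distinct [a, b, c]"
  shows "A Q (P(i := {a, b})) = A Q (P(i := {c, a})) + A Q (P(i := {c, b}))"
proof -
  have "A Q (P(i := {x, y})) = A (P(i := {x, y})) Q" if "x \<noteq> y" "x \<in> {1..n}" "y \<in> {1..n}" for x y
    using assms that by (intro octa_form_sym octahedra_upd) auto
  then show ?thesis
    using octa_form_add_left[OF assms] assms by auto
qed

lemma octa_form_edge_form:
  assumes A: "octa_form n k A" and PQ: "P \<in> octahedra n k" "Q \<in> octahedra n k"
    and i: "i \<in> {1..k+1}"
    and disj: "\<And>j. j \<in> {1..k+1} \<Longrightarrow> j \<noteq> i \<Longrightarrow> P j \<inter> Q j = {}"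
  shows "edge_form n (\<lambda>S T. A (P(i := S)) (Q(i := T)))"
proof -
  have "A (P(i := {a, b})) (Q(i := T)) =
      A (P(i := {c, a})) (Q(i := T)) + A (P(i := {c, b})) (Q(i := T))"
    "A (P(i := T)) (Q(i := {a, b})) =
      A (P(i := T)) (Q(i := {c, a})) + A (P(i := T)) (Q(i := {c, b}))"
    if "T \<in> edges n" "a \<in> {1..n}" "b \<in> {1..n}" "c \<in> {1..n}" "distinct [a, b, c]" for T a b c
    using that PQ i by (auto intro!: octa_form_add_left[OF A] octa_form_add_right[OF A] octahedra_upd
      simp del: distinct.simps)
  moreover have "A (P(i := S)) (Q(i := T)) = 0"
    if "S \<in> edges n" "T \<in> edges n" "S \<inter> T = {}" for S T
    using that PQ i disj
    by (intro octa_form_disjoint[OF A] octahedra_upd) (auto simp: vertex_disjoint_def)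
  ultimately show ?thesis
    unfolding edge_form_def by blast
qed

lemma face_in_faces_iff:
  "{(j, f j) | j. j \<in> {1..k+1}} \<in> faces k P \<longleftrightarrow> (\<forall>j\<in>{1..k+1}. f j \<in> P j)"
proof
  assume "{(j, f j) | j. j \<in> {1..k+1}} \<in> faces k P"
  then obtain a where a: "{(j, f j) | j. j \<in> {1..k+1}} = {(j, a j) | j. j \<in> {1..k+1}}"
      "\<forall>j\<in>{1..k+1}. a j \<in> P j"
    unfolding faces_def by blast
  have "f j = a j" if "j \<in> {1..k+1}" for j
    using eqset_imp_iff[OF a(1), of "(j, f j)"] that by auto
  then show "\<forall>j\<in>{1..k+1}. f j \<in> P j"
    using a(2) by auto
qed (auto simp: faces_def)

lemma faces_upd_sym_diff:
  assumes i: "i \<in> {1..k+1}" and abc: "distinct [a, b, c]"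
  shows "faces k (P(i := {a, b})) = sym_diff (faces k (P(i := {c, a}))) (faces k (P(i := {c, b})))"
proof -
  have upd: "{(j, f j) | j. j \<in> {1..k+1}} \<in> faces k (P(i := S)) \<longleftrightarrow>
      f i \<in> S \<and> (\<forall>j\<in>{1..k+1} - {i}. f j \<in> P j)" for f S
    unfolding face_in_faces_iff using i by auto
  have "F \<in> faces k (P(i := {a, b})) \<longleftrightarrow>
      F \<in> sym_diff (faces k (P(i := {c, a}))) (faces k (P(i := {c, b})))" (is "?l \<longleftrightarrow> ?r") for F
  proof (cases "\<exists>f. F = {(j, f j) | j. j \<in> {1..k+1}}")
    case True
    then obtain f where F: "F = {(j, f j) | j. j \<in> {1..k+1}}"
      by blast
    show ?thesis
      unfolding F Un_iff Diff_iff upd using abc by auto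
  next
    case False
    then have "F \<notin> faces k Q" for Q
      unfolding faces_def by blast
    then show ?thesis
      by blast
  qed
  then show ?thesis
    by blast
qed

section \<open>The normalization sum\<close>

text \<open>Each unordered special pair has exactly one member \<open>P\<close> with \<open>P 1 = {1, 2}\<close>.\<close>

definition special_octahedra :: "nat \<Rightarrow> octahedron set" where
  "special_octahedra k = (\<Pi>\<^sub>E i\<in>{1..k+1}. if i = 1 then {{1, 2}} else {{1, 2}, {1, 3}})"

definition flip :: "nat \<Rightarrow> octahedron \<Rightarrow> octahedron" where
  "flip k P = (\<lambda>i\<in>{1..k+1}. if P i = {1, 2} then {1, 3} else {1, 2})"

lemma one_two_neq_one_three [simp]: "{1, 2} \<noteq> {1, 3 :: nat}" "{Suc 0, 2} \<noteq> {Suc 0, 3}"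
  "{1, 3} \<noteq> {1, 2 :: nat}" "{Suc 0, 3} \<noteq> {Suc 0, 2}"
  by (auto simp: doubleton_eq_iff)

lemma special_octahedra_values:
  assumes "P \<in> special_octahedra k" "i \<in> {1..k+1}"
  shows "P i = {1, 2} \<or> P i = {1, 3}"
  using PiE_mem[OF assms[unfolded special_octahedra_def]] by (auto split: if_splits)

lemma special_octahedra_1:
  assumes "P \<in> special_octahedra k"
  shows "P 1 = {1, 2}"
  using PiE_mem[OF assms[unfolded special_octahedra_def], of 1] by auto

lemma special_octahedra_subset:
  assumes "n \<ge> 3"
  shows "special_octahedra k \<subseteq> octahedra n k"
  unfolding special_octahedra_def octahedra_altdef
  by (rule PiE_mono) (use assms in auto)

lemma flip_in_octahedra:
  assumes "n \<ge> 3"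
  shows "flip k P \<in> octahedra n k"
  using assms unfolding flip_def octahedra_altdef by auto

lemma edges_meeting_in_1:
  assumes "S \<in> edges n" "T \<in> edges n" "S \<subseteq> {1..3}" "T \<subseteq> {1..3}" "S \<inter> T = {1}"
  shows "S = {1, 2} \<and> T = {1, 3} \<or> S = {1, 3} \<and> T = {1, 2}"
proof -
  have "\<exists>u. U = {1, u} \<and> u \<noteq> 1" if "U \<in> edges n" "1 \<in> U" for U
    using that unfolding edges_def card_2_iff by blast
  moreover have "1 \<in> S" "1 \<in> T"
    using assms(5) by blast+
  ultimately obtain s t where s: "S = {1, s}" "s \<noteq> 1" and t: "T = {1, t}" "t \<noteq> 1"
    using assms(1,2) by metis
  have "s \<in> {2, 3}" "t \<in> {2, 3}" "s \<noteq> t"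
    using assms(3-5) s t by auto
  then show ?thesis
    using s t by auto
qed

lemma bij_betw_special_pairs:
  assumes "n \<ge> 3"
  shows "bij_betw (\<lambda>P. {P, flip k P}) (special_octahedra k) (special_pairs n k)"
  unfolding bij_betw_def
proof
  show "inj_on (\<lambda>P. {P, flip k P}) (special_octahedra k)"
  proof (rule inj_onI)
    fix P Q assume PQ: "P \<in> special_octahedra k" "Q \<in> special_octahedra k" "{P, flip k P} = {Q, flip k Q}"
    have "P \<noteq> flip k Q"
      using special_octahedra_1[OF PQ(1)] special_octahedra_1[OF PQ(2)] by (auto simp: flip_def)
    with PQ(3) show "P = Q"
      by (auto simp: doubleton_eq_iff)
  qed
  have sub: "{P, flip k P} \<in> special_pairs n k" if "P \<in> special_octahedra k" for P
  proof -
    have "P i \<subseteq> {1..3} \<and> flip k P i \<subseteq> {1..3} \<and> P i \<inter> flip k P i = {1}" if "i \<in> {1..k+1}" for i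
    proof -
      have "flip k P i = (if P i = {1, 2} then {1, 3} else {1, 2})"
        using that by (simp add: flip_def)
      moreover have "{1, 2} \<subseteq> {1..3::nat}" "{1, 3} \<subseteq> {1..3::nat}" "{1, 2} \<inter> {1, 3} = {1::nat}"
          "{1, 3} \<inter> {1, 2} = {1::nat}"
        by auto
      ultimately show ?thesis
        using special_octahedra_values[OF \<open>P \<in> _\<close> that] by (metis one_two_neq_one_three(3))
    qed
    moreover have "P \<in> octahedra n k" "flip k P \<in> octahedra n k"
      using that special_octahedra_subset[OF assms] flip_in_octahedra[OF assms] by blast+
    ultimately show ?thesis
      unfolding special_pairs_def mem_Collect_eq by (intro exI[of _ P] exI[of _ "flip k P"]) simp
  qed
  have ex: "P \<in> special_octahedra k \<and> Q = flip k P"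
    if "P \<in> octahedra n k" "Q \<in> octahedra n k" "P 1 = {1, 2}" and
      cases: "\<And>i. i \<in> {1..k+1} \<Longrightarrow> P i = {1, 2} \<and> Q i = {1, 3} \<or> P i = {1, 3} \<and> Q i = {1, 2}" for P Q
  proof
    show "P \<in> special_octahedra k"
      unfolding special_octahedra_def
    proof (rule PiE_I)
      show "P i \<in> (if i = 1 then {{1, 2}} else {{1, 2}, {1, 3}})" if "i \<in> {1..k+1}" for i
      proof (cases "i = 1")
        case True
        then show ?thesis
          by (simp add: \<open>P 1 = {1, 2}\<close> del: One_nat_def)
      next
        case False
        moreover have "P i = {1, 2} \<or> P i = {1, 3}"
          using cases[OF that] by blast
        ultimately show ?thesis
          by simp
      qed
      show "P i = undefined" if "i \<notin> {1..k+1}" for i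
        using \<open>P \<in> octahedra n k\<close> that unfolding octahedra_altdef by (rule PiE_arb)
    qed
    show "Q = flip k P"
    proof
      fix i show "Q i = flip k P i"
      proof (cases "i \<in> {1..k+1}")
        case True
        then show ?thesis
          using cases[OF True] by (auto simp: flip_def)
      next
        case False
        then show ?thesis
          using PiE_arb[OF \<open>Q \<in> octahedra n k\<close>[unfolded octahedra_altdef] False]
          by (auto simp: flip_def)
      qed
    qed
  qed
  show "(\<lambda>P. {P, flip k P}) ` special_octahedra k = special_pairs n k"
  proof (intro equalityI subsetI)
    fix e assume "e \<in> special_pairs n k"
    then obtain P Q where e: "e = {P, Q}" and PQ: "P \<in> octahedra n k" "Q \<in> octahedra n k"
      and *: "\<forall>i\<in>{1..k+1}. P i \<subseteq> {1..3} \<and> Q i \<subseteq> {1..3} \<and> P i \<inter> Q i = {1}"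
      unfolding special_pairs_def mem_Collect_eq by (elim exE conjE) (rule that)
    have **: "P i = {1, 2} \<and> Q i = {1, 3} \<or> P i = {1, 3} \<and> Q i = {1, 2}" if "i \<in> {1..k+1}" for i
      using edges_meeting_in_1[OF PQ[unfolded octahedra_altdef, THEN PiE_mem, OF that]] bspec[OF * that]
      by blast
    have "P \<in> special_octahedra k \<and> Q = flip k P \<or> Q \<in> special_octahedra k \<and> P = flip k Q"
    proof (cases "P 1 = {1, 2}")
      case True
      then show ?thesis
        using ex[OF PQ _ **] by blast
    next
      case False
      then have "Q 1 = {1, 2}"
        using **[of 1] by auto
      then show ?thesis
        using ex[OF PQ(2,1)] ** by blast
    qed
    then show "e \<in> (\<lambda>P. {P, flip k P}) ` special_octahedra k"
      using e by (auto simp: insert_commute)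
  qed (use sub in auto)
qed

definition special_sum :: "nat \<Rightarrow> (octahedron \<Rightarrow> octahedron \<Rightarrow> bit) \<Rightarrow> bit" where
  "special_sum k A = (\<Sum>P\<in>special_octahedra k. A P (flip k P))"

lemma sum_special_pairs:
  assumes "n \<ge> 3" "octa_form n k A"
  shows "(\<Sum>e\<in>special_pairs n k. pair_entry A e) = special_sum k A"
proof -
  have "(\<Sum>e\<in>special_pairs n k. pair_entry A e) = (\<Sum>P\<in>special_octahedra k. pair_entry A {P, flip k P})"
    by (rule sum.reindex_bij_betw[OF bij_betw_special_pairs[OF assms(1)], symmetric])
  also have "\<dots> = special_sum k A"
    unfolding special_sum_def
  proof (rule sum.cong)
    fix P assume "P \<in> special_octahedra k"
    then show "pair_entry A {P, flip k P} = A P (flip k P)"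
      using special_octahedra_subset[OF assms(1)] flip_in_octahedra[OF assms(1)]
      by (intro pair_entry_eq octa_form_sym[OF assms(2)]) auto
  qed simp
  finally show ?thesis .
qed

lemma nk_matrix_octa_form:
  assumes A: "nk_matrix n k A" and "n \<ge> 3"
  shows "octa_form n k A" "special_sum k A = 1"
proof -
  have add: "A P Q = A X Q + A Y Q"
    if "P \<in> octahedra n k" "X \<in> octahedra n k" "Y \<in> octahedra n k" "Q \<in> octahedra n k"
      "faces k P = sym_diff (faces k X) (faces k Y)" for P X Y Q
    using A that unfolding nk_matrix_def by blast
  have "A (P(i := {a, b})) Q = A (P(i := {c, a})) Q + A (P(i := {c, b})) Q"
    if "P \<in> octahedra n k" "Q \<in> octahedra n k" "i \<in> {1..k+1}"
      "a \<in> {1..n}" "b \<in> {1..n}" "c \<in> {1..n}" "distinct [a, b, c]" for P Q i a b c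
    using that by (intro add octahedra_upd faces_upd_sym_diff) auto
  then show form: "octa_form n k A"
    using A unfolding octa_form_def nk_matrix_def by blast
  show "special_sum k A = 1"
    using sum_special_pairs[OF \<open>n \<ge> 3\<close> form] A by (simp add: nk_matrix_def)
qed

section \<open>Lowering the dimension\<close>

definition contract :: "nat \<Rightarrow> (octahedron \<Rightarrow> octahedron \<Rightarrow> bit) \<Rightarrow> octahedron \<Rightarrow> octahedron \<Rightarrow> bit" where
  "contract k A P Q = A (P(k+2 := {1, 2})) (Q(k+2 := {1, 3})) + A (P(k+2 := {1, 3})) (Q(k+2 := {1, 2}))"

lemma octa_form_contract:
  assumes A: "octa_form n (k+1) A" and "n \<ge> 4"
  shows "octa_form n k (contract k A)"
  unfolding octa_form_def
proof (intro conjI ballI impI)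
  have e: "{1, 2} \<in> edges n" "{1, 3} \<in> edges n"
    using \<open>n \<ge> 4\<close> by auto
  fix P Q assume P: "P \<in> octahedra n k" and Q: "Q \<in> octahedra n k"
  note ext = octahedra_extend[OF P] octahedra_extend[OF Q]
  show "contract k A P Q = contract k A Q P"
    unfolding contract_def using ext e octa_form_sym[OF A] by (metis add.commute)
  show "contract k A P Q = 0" if "vertex_disjoint k P Q"
  proof -
    have "edge_form n (\<lambda>S T. A ((P(k+2 := {1, 2}))(k+2 := S)) ((Q(k+2 := {1, 2}))(k+2 := T)))"
      using that ext e by (intro octa_form_edge_form[OF A]) (auto simp: vertex_disjoint_def)
    from edge_form_const[OF this \<open>n \<ge> 4\<close>, of 1 2 3 3 2]
    have "A (P(k+2 := {1, 2})) (Q(k+2 := {1, 3})) = A (P(k+2 := {1, 3})) (Q(k+2 := {1, 2}))"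
      using \<open>n \<ge> 4\<close> by simp
    then show ?thesis
      by (simp add: contract_def)
  qed
  fix i a b c assume i: "i \<in> {1..k+1}" and abc: "a \<in> {1..n}" "b \<in> {1..n}" "c \<in> {1..n}" "distinct [a, b, c]"
  have "A ((P(i := {a, b}))(k+2 := S)) (Q(k+2 := T)) =
      A ((P(i := {c, a}))(k+2 := S)) (Q(k+2 := T)) + A ((P(i := {c, b}))(k+2 := S)) (Q(k+2 := T))"
    if "S \<in> edges n" "T \<in> edges n" for S T
  proof -
    have "(P(i := U))(k+2 := S) = (P(k+2 := S))(i := U)" for U
      using i by (intro fun_upd_twist) auto
    then show ?thesis
      using octa_form_add_left[OF A ext(1)[OF that(1)] ext(2)[OF that(2)] _ abc] i by simp
  qed
  then show "contract k A (P(i := {a, b})) Q =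
      contract k A (P(i := {c, a})) Q + contract k A (P(i := {c, b})) Q"
    unfolding contract_def using e by (simp add: algebra_simps)
qed

lemma flip_extend:
  "flip (k+1) (P(k+2 := {1, 2})) = (flip k P)(k+2 := {1, 3})"
  "flip (k+1) (P(k+2 := {1, 3})) = (flip k P)(k+2 := {1, 2})"
  by (auto simp: flip_def fun_eq_iff)

lemma special_sum_contract: "special_sum k (contract k A) = special_sum (k+1) A"
proof -
  let ?T = "\<lambda>i::nat. if i = 1 then {{1, 2}} else {{1, 2}, {1, 3 :: nat}}"
  let ?h = "\<lambda>(S, P). P(k+2 := S)"
  have "{1..k+1+1} = insert (k+2) {1..k+1}"
    by auto
  then have "special_octahedra (k+1) = Pi\<^sub>E (insert (k+2) {1..k+1}) ?T"
    unfolding special_octahedra_def by metis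
  then have eq: "special_octahedra (k+1) = ?h ` ({{1, 2}, {1, 3}} \<times> special_octahedra k)"
    unfolding PiE_insert_eq special_octahedra_def by simp
  have inj: "inj_on ?h ({{1, 2}, {1, 3}} \<times> special_octahedra k)"
    using inj_combinator[of "k+2" "{1..k+1}" ?T] by (simp add: special_octahedra_def)
  have "special_sum (k+1) A =
      (\<Sum>(S, P)\<in>{{1, 2}, {1, 3}} \<times> special_octahedra k. A (P(k+2 := S)) (flip (k+1) (P(k+2 := S))))"
    unfolding special_sum_def eq by (subst sum.reindex[OF inj]) (simp add: case_prod_unfold)
  also have "\<dots> = (\<Sum>S\<in>{{1, 2}, {1, 3}}. \<Sum>P\<in>special_octahedra k. A (P(k+2 := S)) (flip (k+1) (P(k+2 := S))))"
    by (rule sum.cartesian_product[symmetric])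
  also have "\<dots> = special_sum k (contract k A)"
    using flip_extend by (simp add: special_sum_def contract_def sum.distrib)
  finally show ?thesis ..
qed

lemma mat_rank_contract:
  assumes "n \<ge> 3"
  shows "mat_rank (octahedra n k) (octahedra n k) (contract k A)
    \<le> 2 * mat_rank (octahedra n (k+1)) (octahedra n (k+1)) A"
proof -
  let ?O = "octahedra n k" and ?O' = "octahedra n (k+1)"
  have "mat_rank ?O ?O (\<lambda>P Q. A (P(k+2 := S)) (Q(k+2 := T))) \<le> mat_rank ?O' ?O' A"
    if "S \<in> edges n" "T \<in> edges n" for S T
    by (rule mat_rank_reindex_le[where f = "\<lambda>P. P(k+2 := S)" and g = "\<lambda>Q. Q(k+2 := T)"])
      (use that octahedra_extend in auto)
  from this[of "{1, 2}" "{1, 3}"] this[of "{1, 3}" "{1, 2}"]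
  have "mat_rank ?O ?O (\<lambda>P Q. A (P(k+2 := {1, 2})) (Q(k+2 := {1, 3})))
      + mat_rank ?O ?O (\<lambda>P Q. A (P(k+2 := {1, 3})) (Q(k+2 := {1, 2}))) \<le> 2 * mat_rank ?O' ?O' A"
    using assms by simp
  moreover have "mat_rank ?O ?O (contract k A) \<le> mat_rank ?O ?O (\<lambda>P Q. A (P(k+2 := {1, 2})) (Q(k+2 := {1, 3})))
      + mat_rank ?O ?O (\<lambda>P Q. A (P(k+2 := {1, 3})) (Q(k+2 := {1, 2})))"
    by (rule mat_rank_add_le) (auto simp: contract_def)
  ultimately show ?thesis
    by linarith
qed

section \<open>One-dimensional octahedra\<close>

definition cyc4 :: "nat set \<Rightarrow> nat set \<Rightarrow> octahedron" where
  "cyc4 S T = (\<lambda>_. undefined)(1 := S, 2 := T)"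

lemma cyc4_simps [simp]: "cyc4 S T 1 = S" "cyc4 S T (Suc 0) = S" "cyc4 S T 2 = T"
    "(cyc4 S T)(1 := S') = cyc4 S' T" "(cyc4 S T)(Suc 0 := S') = cyc4 S' T" "(cyc4 S T)(2 := T') = cyc4 S T'"
  by (auto simp: cyc4_def fun_eq_iff)

lemma cyc4_in_octahedra: "S \<in> edges n \<Longrightarrow> T \<in> edges n \<Longrightarrow> cyc4 S T \<in> octahedra n 1"
  unfolding octahedra_altdef by (rule PiE_I) (auto simp: cyc4_def)

lemma atLeastAtMost_1_2: "{1..1+1} = {1, 2 :: nat}"
  by auto

lemma special_octahedra_1_eq: "special_octahedra 1 = {cyc4 {1, 2} {1, 2}, cyc4 {1, 2} {1, 3}}"
proof -
  have "special_octahedra 1 = (\<Pi>\<^sub>E i\<in>insert 2 {1}. if i = 1 then {{1, 2}} else {{1, 2}, {1, 3 :: nat}})"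
    unfolding special_octahedra_def atLeastAtMost_1_2 by (metis insert_commute)
  also have "\<dots> = {cyc4 {1, 2} {1, 2}, cyc4 {1, 2} {1, 3}}"
    unfolding PiE_insert_eq by (auto simp: cyc4_def)
  finally show ?thesis .
qed

lemma flip_cyc4:
  "flip 1 (cyc4 {1, 2} {1, 2}) = cyc4 {1, 3} {1, 3}" "flip 1 (cyc4 {1, 2} {1, 3}) = cyc4 {1, 3} {1, 2}"
  by (auto simp: flip_def cyc4_def fun_eq_iff)

locale cyc4_form =
  fixes n :: nat and A :: "octahedron \<Rightarrow> octahedron \<Rightarrow> bit"
  assumes n: "n \<ge> 4" and A: "octa_form n 1 A" and norm: "special_sum 1 A = 1"
begin

definition a :: "nat set \<Rightarrow> nat set \<Rightarrow> nat set \<Rightarrow> nat set \<Rightarrow> bit" where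
  "a S S' T T' = A (cyc4 S T) (cyc4 S' T')"

lemma a_sym:
  assumes "S \<in> edges n" "S' \<in> edges n" "T \<in> edges n" "T' \<in> edges n"
  shows "a S S' T T' = a S' S T' T"
  unfolding a_def using assms by (intro octa_form_sym[OF A] cyc4_in_octahedra)

lemma a_add:
  assumes "S \<in> edges n" "T \<in> edges n" "T' \<in> edges n"
    and "x \<in> {1..n}" "y \<in> {1..n}" "z \<in> {1..n}" "distinct [x, y, z]"
  shows "a {x, y} S T T' = a {z, x} S T T' + a {z, y} S T T'"
    and "a S {x, y} T T' = a S {z, x} T T' + a S {z, y} T T'"
    and "a T T' {x, y} S = a T T' {z, x} S + a T T' {z, y} S"
    and "a T T' S {x, y} = a T T' S {z, x} + a T T' S {z, y}"
proof -
  have e: "{x, y} \<in> edges n" "{z, x} \<in> edges n" "{z, y} \<in> edges n"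
    using assms by auto
  show L: "a {x, y} S T T' = a {z, x} S T T' + a {z, y} S T T'"
    using octa_form_add_left[OF A cyc4_in_octahedra[of S n T] cyc4_in_octahedra[of S n T'] _ assms(4-7), of 1] assms
    by (simp add: a_def)
  show R: "a T T' {x, y} S = a T T' {z, x} S + a T T' {z, y} S"
    using octa_form_add_left[OF A cyc4_in_octahedra[of T n T] cyc4_in_octahedra[of T' n S] _ assms(4-7), of 2] assms
    by (simp add: a_def)
  show "a S {x, y} T T' = a S {z, x} T T' + a S {z, y} T T'"
    using octa_form_add_right[OF A cyc4_in_octahedra[of S n T'] cyc4_in_octahedra[of S n T] _ assms(4-7), of 1] assms
    by (simp add: a_def)
  show "a T T' S {x, y} = a T T' S {z, x} + a T T' S {z, y}"
    using octa_form_add_right[OF A cyc4_in_octahedra[of T' n T] cyc4_in_octahedra[of T n S] _ assms(4-7), of 2] assms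
    by (simp add: a_def)
qed

lemma a_edge_form:
  assumes "S \<in> edges n" "S' \<in> edges n" "S \<inter> S' = {}"
  shows "edge_form n (a S S')" "edge_form n (\<lambda>T T'. a T T' S S')"
proof -
  have disj: "cyc4 S S j \<inter> cyc4 S' S' j = {}" if "j \<in> {1..1+1}" for j
  proof -
    have "j = 1 \<or> j = 2"
      using that by auto
    then show ?thesis
      using assms(3) by auto
  qed
  have "edge_form n (\<lambda>T T'. A ((cyc4 S S)(2 := T)) ((cyc4 S' S')(2 := T')))"
    using assms disj by (intro octa_form_edge_form[OF A] cyc4_in_octahedra) auto
  then show "edge_form n (a S S')"
    by (simp add: a_def[abs_def])
  have "edge_form n (\<lambda>T T'. A ((cyc4 S S)(1 := T)) ((cyc4 S' S')(1 := T')))"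
    using assms disj by (intro octa_form_edge_form[OF A] cyc4_in_octahedra) auto
  then show "edge_form n (\<lambda>T T'. a T T' S S')"
    by (simp add: a_def)
qed

definition G :: "nat set \<Rightarrow> nat set \<Rightarrow> nat set \<Rightarrow> nat set \<Rightarrow> bit" where
  "G S S' T T' = a S S' T T' + a S S' T' T"

lemma G_const:
  assumes "b \<in> {2..n}" "c \<in> {2..n}" "b \<noteq> c" "x \<in> {2..n}" "y \<in> {2..n}" "x \<noteq> y"
  shows "G {1, b} {1, c} {1, x} {1, y} = 1"
proof -
  have e: "{1, d} \<in> edges n" if "d \<in> {2..n}" for d
    using that by auto
  have 1: "edge_form n (G {1, b} {1, c})"
  proof -
    have "G {1, b} {1, c} {x, y} T = G {1, b} {1, c} {z, x} T + G {1, b} {1, c} {z, y} T \<and>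
        G {1, b} {1, c} T {x, y} = G {1, b} {1, c} T {z, x} + G {1, b} {1, c} T {z, y}"
      if "T \<in> edges n" "x \<in> {1..n}" "y \<in> {1..n}" "z \<in> {1..n}" "distinct [x, y, z]" for T x y z
      unfolding G_def a_add(3)[OF that(1) e[OF assms(1)] e[OF assms(2)] that(2-5)]
        a_add(4)[OF that(1) e[OF assms(1)] e[OF assms(2)] that(2-5)]
      by (simp add: algebra_simps)
    moreover have "G {1, b} {1, c} S T = 0" if "S \<in> edges n" "T \<in> edges n" "S \<inter> T = {}" for S T
    proof -
      have "a {1, b} {1, c} S T = a {1, c} {1, b} S T"
        using edge_form_const[OF a_edge_form(2)[OF that] n, of 1 b c c b] assms n by auto
      also have "\<dots> = a {1, b} {1, c} T S"
        using assms that e by (intro a_sym) auto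
      finally show ?thesis
        by (simp add: G_def)
    qed
    ultimately show ?thesis
      unfolding edge_form_def by blast
  qed
  have 2: "edge_form n (\<lambda>S S'. G S S' {1, 2} {1, 3})"
  proof -
    have e3: "{1, 2} \<in> edges n" "{1, 3} \<in> edges n"
      using n by auto
    have "G {x, y} T {1, 2} {1, 3} = G {z, x} T {1, 2} {1, 3} + G {z, y} T {1, 2} {1, 3} \<and>
        G T {x, y} {1, 2} {1, 3} = G T {z, x} {1, 2} {1, 3} + G T {z, y} {1, 2} {1, 3}"
      if "T \<in> edges n" "x \<in> {1..n}" "y \<in> {1..n}" "z \<in> {1..n}" "distinct [x, y, z]" for T x y z
      unfolding G_def a_add(1)[OF that(1) e3 that(2-5)] a_add(1)[OF that(1) e3(2,1) that(2-5)]
        a_add(2)[OF that(1) e3 that(2-5)] a_add(2)[OF that(1) e3(2,1) that(2-5)]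
      by (simp add: algebra_simps)
    moreover have "G S T {1, 2} {1, 3} = 0" if "S \<in> edges n" "T \<in> edges n" "S \<inter> T = {}" for S T
      using edge_form_const[OF a_edge_form(1)[OF that] n, of 1 2 3 3 2] n by (simp add: G_def)
    ultimately show ?thesis
      unfolding edge_form_def by blast
  qed
  have "G {1, b} {1, c} {1, x} {1, y} = G {1, b} {1, c} {1, 2} {1, 3}"
    using assms n by (intro edge_form_const[OF 1]) auto
  also have "\<dots> = G {1, 2} {1, 3} {1, 2} {1, 3}"
    using assms n by (intro edge_form_const[OF 2]) auto
  also have "\<dots> = special_sum 1 A"
  proof -
    have "cyc4 {1, 2} {1, 2} \<noteq> cyc4 {1, 2} {1, 3}"
      by (metis cyc4_simps(3) one_two_neq_one_three(1))
    then show ?thesis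
      unfolding special_sum_def special_octahedra_1_eq by (simp add: flip_cyc4 G_def a_def del: One_nat_def)
  qed
  finally show ?thesis
    using norm by simp
qed

lemma a_tournament:
  assumes "b \<in> {3..n}" "x \<in> {2..n}" "y \<in> {2..n}" "x \<noteq> y"
  shows "a {2, b} {1, b} {1, x} {1, y} + a {2, b} {1, b} {1, y} {1, x} = 1"
proof -
  have add: "a {2, b} {1, b} T T' = a {1, 2} {1, b} T T' + a {1, b} {1, b} T T'"
    if "T \<in> edges n" "T' \<in> edges n" for T T'
    using a_add(1)[of "{1, b}" T T' 2 b 1] that assms n by auto
  have e: "{1, d} \<in> edges n" if "d \<in> {2..n}" for d
    using that by auto
  have cancel: "p + q + (r + q) = p + r" for p q r :: bit
    by (cases p; cases q; cases r) auto
  have "a {1, b} {1, b} {1, x} {1, y} = a {1, b} {1, b} {1, y} {1, x}"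
    using assms e by (intro a_sym) auto
  then have "a {2, b} {1, b} {1, x} {1, y} + a {2, b} {1, b} {1, y} {1, x} = G {1, 2} {1, b} {1, x} {1, y}"
    unfolding add[OF e[OF assms(2)] e[OF assms(3)]] add[OF e[OF assms(3)] e[OF assms(2)]] G_def
    by (simp only: cancel)
  also have "\<dots> = 1"
    using assms n by (intro G_const) auto
  finally show ?thesis .
qed

lemma a_off_diagonal:
  assumes "b \<in> {3..n}" "c \<in> {3..n}" "b \<noteq> c" "x \<in> {2..n}" "y \<in> {2..n}" "x \<noteq> y"
  shows "a {2, b} {1, c} {1, x} {1, y} = a {2, b} {1, c} {1, 2} {1, 3}"
  using assms n by (intro edge_form_const[OF a_edge_form(1) n]) auto

lemma rank_ge: "(n - 2)^2 \<le> 2 * mat_rank (octahedra n 1) (octahedra n 1) A + 2 * (n - 3)"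
proof -
  let ?I = "{..<n-2} \<times> {2..n}"
  define B where "B = (\<lambda>(b, x) (c, y). a {2, b+3} {1, c+3} {1, x} {1, y})"
  define E where "E = (\<lambda>(b, x :: nat) (c, y :: nat).
    if b < c then a {2, b+3} {1, c+3} {1, 2} {1, 3} else 0)"
  let ?N = "\<lambda>i j. B i j + E i j"
  have "(\<Sum>b<n-2. card {2..n}) \<le> 2 * mat_rank (Sigma {..<n-2} (\<lambda>_. {2..n})) (Sigma {..<n-2} (\<lambda>_. {2..n})) ?N + (n - 2)"
  proof (rule block_tournament_rank)
    fix b c x y :: nat assume "b < c" "c < n - 2" "x \<in> {2..n}" "y \<in> {2..n}" "x \<noteq> y"
    then show "?N (b, x) (c, y) = 0"
      using a_off_diagonal[of "b+3" "c+3" x y] by (simp add: B_def E_def)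
  next
    fix b x y :: nat assume "b < n - 2" "x \<in> {2..n}" "y \<in> {2..n}" "x \<noteq> y"
    then show "?N (b, x) (b, y) + ?N (b, y) (b, x) = 1"
      using a_tournament[of "b+3" x y] by (simp add: B_def E_def)
  qed auto
  moreover have "mat_rank ?I ?I ?N \<le> mat_rank ?I ?I B + mat_rank ?I ?I E"
    by (rule mat_rank_add_le) auto
  moreover have "mat_rank ?I ?I B \<le> mat_rank (octahedra n 1) (octahedra n 1) A"
    by (rule mat_rank_reindex_le[where f = "\<lambda>(b, x). cyc4 {2, b+3} {1, x}" and g = "\<lambda>(c, y). cyc4 {1, c+3} {1, y}"])
      (auto simp: B_def a_def simp del: One_nat_def intro!: cyc4_in_octahedra)
  moreover have "mat_rank ?I ?I E \<le> card {1..<n-2}"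
  proof (rule mat_rank_le[where u = "\<lambda>d i. E i (d, 0)" and v = "\<lambda>d j. of_bool (fst j = d)"])
    fix i j assume ij: "i \<in> ?I" "j \<in> ?I"
    have "(\<Sum>d\<in>{1..<n-2}. E i (d, 0) * of_bool (fst j = d)) = (if fst j \<in> {1..<n-2} then E i (fst j, 0) else 0)"
      by (simp add: of_bool_def if_distrib cong: if_cong)
    also have "\<dots> = E i j"
      using ij by (auto simp: E_def)
    finally show "E i j = (\<Sum>d\<in>{1..<n-2}. E i (d, 0) * of_bool (fst j = d))" ..
  qed simp
  ultimately have "(n - 2) * (n - 1) \<le> 2 * mat_rank (octahedra n 1) (octahedra n 1) A + 2 * (n - 3) + (n - 2)"
    by simp
  moreover have "(n - 2) * (n - 1) = (n - 2)^2 + (n - 2)"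
  proof -
    obtain m where "n = 4 + m"
      using n le_Suc_ex by blast
    then show ?thesis
      by (simp add: power2_eq_square algebra_simps)
  qed
  ultimately show ?thesis
    by linarith
qed

end

lemma octa_form_rank:
  assumes "n \<ge> 4" "octa_form n (k+1) A" "special_sum (k+1) A = 1"
  shows "(n - 3)^2 \<le> 2^(k+1) * mat_rank (octahedra n (k+1)) (octahedra n (k+1)) A"
  using assms(2,3)
proof (induction k arbitrary: A)
  case 0
  interpret cyc4_form n A
    using 0 assms(1) by unfold_locales auto
  obtain m where "n = 4 + m"
    using assms(1) le_Suc_ex by blast
  then show ?case
    using rank_ge by (simp add: power2_eq_square)
next
  case (Suc k)
  let ?r = "\<lambda>k A. mat_rank (octahedra n k) (octahedra n k) A"
  have "(n - 3)^2 \<le> 2^(k+1) * ?r (k+1) (contract (k+1) A)"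
    using Suc.prems octa_form_contract[of n "k+1" A] special_sum_contract[of "k+1" A] assms(1)
    by (intro Suc.IH) auto
  also have "\<dots> \<le> 2^(k+1) * (2 * ?r (k+1+1) A)"
    using assms(1) by (intro mult_left_mono mat_rank_contract) auto
  finally show ?case
    by simp
qed

theorem theorem1p5:
  fixes n k :: nat and A :: "octahedron \<Rightarrow> octahedron \<Rightarrow> bit"
  assumes "k \<ge> 1" and "n \<ge> 4" and "nk_matrix n k A"
  shows "real (mat_rank (octahedra n k) (octahedra n k) A) \<ge> (real n - 3)^2 / 2^k"
proof -
  let ?r = "mat_rank (octahedra n k) (octahedra n k) A"
  obtain l where k: "k = l + 1"
    using assms(1) by (metis add.commute le_Suc_ex)
  have "(n - 3)^2 \<le> 2^k * ?r"
    unfolding k using assms nk_matrix_octa_form[of n k A] by (intro octa_form_rank) (auto simp: k)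
  then have "real ((n - 3)^2) \<le> real (2^k * ?r)"
    by (rule of_nat_mono)
  then have "(real n - 3)^2 \<le> 2^k * real ?r"
    using assms(2) by (simp add: of_nat_diff)
  then show ?thesis
    by (simp add: divide_le_eq mult.commute)
qed

end
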